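(* For any convex polytope $P$, $$s(P)=s(G_P)=s(K_P)=s(U_P).$$
   Context: Let $P=\{x\in\mathbb{R}^n\mid \langle a_i,x\rangle+b_i\geqslant 0,\ i=1,\dots,m\}$ be a (bounded) $n$-dimensional convex polytope, not necessarily simple, whose facets are exactly the $m$ distinct sets $\mathcal{F}_i=\{x\in P\mid\langle a_i,x\rangle+b_i=0\}$. Write $[m]=\{1,\dots,m\}$. The torus $T^m=(S^1)^m$ acts on $\mathbb{C}^m$ coordinatewise; a toric subgroup of rank $k$ is a subgroup of $T^m$ that is a $k$-dimensional subtorus. Hypergraphs: a hypergraph is a subset $G\subseteq 2^{[m]}$. $G_P=\{\{i\mid x\in\mathcal{F}_i\}: x\in P\}$, and $K_P$ is its simplicial closure (smallest simplicial complex containing $G_P$), i.e. $\{i_1,\dots,i_k\}\in K_P$ iff $\mathcal{F}_{i_1}\cap\dots\cap\mathcal{F}_{i_k}\neq\varnothing$. Spaces with $T^m$-action: (a) $\mathcal{Z}_P=p^{-1}(j_P(P))\subset\mathbb{C}^m$, where $j_P(x)=(\langle a_1,x\rangle+b_1,\dots,\langle a_m,x\rangle+b_m)$ and $p(z_1,\dots,z_m)=(|z_1|^2,\dots,|z_m|^2)$. (b) For a pair $(X,A)$ and a hypergraph $G$, $(X,A)^G=\bigcup_{\alpha\in G}X^\alpha\times A^{[m]\setminus\alpha}\subseteq X^m$. For a hypergraph $G$ (in particular for a simplicial complex), $\mathcal{Z}_G=(D^2,S^1)^G$, with $D^2\subset\mathbb{C}$ the closed unit disk. (c) $U_P=(\mathbb{C},\mathbb{C}\setminus\{0\})^{G_P}=(\mathbb{C},\mathbb{C}\setminus\{0\})^{K_P}\subseteq\mathbb{C}^m$,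 the complement of the corresponding coordinate subspace arrangement. Buchstaber numbers: $s(P)$, $s(G)$ (for $G$ a hypergraph, in particular $G=G_P$ or $G=K_P$), and $s(U_P)$ are the maximal ranks of toric subgroups of $T^m$ acting freely on $\mathcal{Z}_P$, on $\mathcal{Z}_G$, and on $U_P$ respectively. *)

theory Defs
  imports
    "HOL-Algebra.Product_Groups"
    "HOL-Algebra.Group_Action"
    "HOL-Analysis.Analysis"
begin

section \<open>Polytopes given by inequalities\<close>

definition presented_polytope :: "nat \<Rightarrow> (nat \<Rightarrow> 'a::euclidean_space) \<Rightarrow> (nat \<Rightarrow> real) \<Rightarrow> 'a set" where
  "presented_polytope m a b = {x. \<forall>i\<in>{1..m}. a i \<bullet> x + b i \<ge> 0}"

definition presented_facet :: "nat \<Rightarrow> (nat \<Rightarrow> 'a::euclidean_space) \<Rightarrow> (nat \<Rightarrow> real) \<Rightarrow> nat \<Rightarrow> 'a set" where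
  "presented_facet m a b i = {x \<in> presented_polytope m a b. a i \<bullet> x + b i = 0}"


section \<open>Tori and toric subgroups\<close>

definition circle_group :: "complex monoid" where
  "circle_group = \<lparr>carrier = sphere 0 1, monoid.mult = (*), one = 1\<rparr>"

text \<open>
  The torus of dimension \<open>k\<close>, as a group and as a topological space. Points of a \<open>k\<close>-fold product
  are functions on \<open>{1..k}\<close> that are \<open>undefined\<close> elsewhere, so that the rank is an ordinary
  natural number over which a maximum can be taken.
\<close>

definition torus :: "nat \<Rightarrow> (nat \<Rightarrow> complex) monoid" where
  "torus k = product_group {1..k} (\<lambda>_. circle_group)"

definition torus_topology :: "nat \<Rightarrow> (nat \<Rightarrow> complex) topology" where
  "torus_topology k = product_topology (\<lambda>_. top_of_set (sphere 0 1)) {1..k}"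

definition toric_subgroup :: "nat \<Rightarrow> nat \<Rightarrow> (nat \<Rightarrow> complex) set \<Rightarrow> bool" where
  "toric_subgroup m k H \<longleftrightarrow>
     subgroup H (torus m) \<and>
     (\<exists>f. f \<in> iso (torus k) (torus m \<lparr>carrier := H\<rparr>) \<and>
          homeomorphic_map (torus_topology k) (subtopology (torus_topology m) H) f)"


section \<open>Free coordinatewise actions and Buchstaber numbers\<close>

definition coordinatewise_action ::
    "nat \<Rightarrow> (nat \<Rightarrow> complex) set \<Rightarrow> (nat \<Rightarrow> complex) \<Rightarrow> (nat \<Rightarrow> complex) \<Rightarrow> (nat \<Rightarrow> complex)" where
  "coordinatewise_action m Z t = (\<lambda>z\<in>Z. \<lambda>i\<in>{1..m}. t i * z i)"

definition acts_freely :: "nat \<Rightarrow> (nat \<Rightarrow> complex) set \<Rightarrow> (nat \<Rightarrow> complex) set \<Rightarrow> bool" where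
  "acts_freely m H Z \<longleftrightarrow>
     group_action (torus m \<lparr>carrier := H\<rparr>) Z (coordinatewise_action m Z) \<and>
     (\<forall>z\<in>Z. stabilizer (torus m \<lparr>carrier := H\<rparr>) (coordinatewise_action m Z) z = {\<one>\<^bsub>torus m\<^esub>})"

text \<open>
  For a set \<open>Z\<close> stable under the whole torus, the maximum is over a finite set (lemma
  \<open>toric_subgroup_rank_le\<close>) that contains \<open>0\<close> (lemma \<open>trivial_acts_freely\<close>).
\<close>

definition buchstaber_number :: "nat \<Rightarrow> (nat \<Rightarrow> complex) set \<Rightarrow> nat" where
  "buchstaber_number m Z = Max {k. \<exists>H. toric_subgroup m k H \<and> acts_freely m H Z}"


section \<open>Hypergraphs and polyhedral products\<close>

definition abstract_complex :: "nat \<Rightarrow> nat set set \<Rightarrow> bool" where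
  "abstract_complex m K \<longleftrightarrow>
     K \<subseteq> Pow {1..m} \<and> {} \<in> K \<and> (\<forall>\<alpha>\<in>K. \<forall>\<beta>. \<beta> \<subseteq> \<alpha> \<longrightarrow> \<beta> \<in> K)"

definition simplicial_closure :: "nat \<Rightarrow> nat set set \<Rightarrow> nat set set" where
  "simplicial_closure m G = abstract_complex m hull G"

definition polyhedral_product :: "nat \<Rightarrow> 'a set \<Rightarrow> 'a set \<Rightarrow> nat set set \<Rightarrow> (nat \<Rightarrow> 'a) set" where
  "polyhedral_product m X A G = (\<Union>\<alpha>\<in>G. \<Pi>\<^sub>E i\<in>{1..m}. if i \<in> \<alpha> then X else A)"

definition moment_angle :: "nat \<Rightarrow> nat set set \<Rightarrow> (nat \<Rightarrow> complex) set" where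
  "moment_angle m G = polyhedral_product m (cball 0 1) (sphere 0 1) G"


section \<open>Hypergraphs and spaces associated with a polytope\<close>

definition polytope_hypergraph ::
    "nat \<Rightarrow> (nat \<Rightarrow> 'a::euclidean_space) \<Rightarrow> (nat \<Rightarrow> real) \<Rightarrow> nat set set" where
  "polytope_hypergraph m a b =
     (\<lambda>x. {i\<in>{1..m}. x \<in> presented_facet m a b i}) ` presented_polytope m a b"

definition polytope_complex ::
    "nat \<Rightarrow> (nat \<Rightarrow> 'a::euclidean_space) \<Rightarrow> (nat \<Rightarrow> real) \<Rightarrow> nat set set" where
  "polytope_complex m a b = simplicial_closure m (polytope_hypergraph m a b)"

definition polytope_map ::
    "nat \<Rightarrow> (nat \<Rightarrow> 'a::euclidean_space) \<Rightarrow> (nat \<Rightarrow> real) \<Rightarrow> 'a \<Rightarrow> (nat \<Rightarrow> real)" where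
  "polytope_map m a b x = (\<lambda>i\<in>{1..m}. a i \<bullet> x + b i)"

definition moment_map :: "nat \<Rightarrow> (nat \<Rightarrow> complex) \<Rightarrow> (nat \<Rightarrow> real)" where
  "moment_map m z = (\<lambda>i\<in>{1..m}. (cmod (z i))\<^sup>2)"

definition polytope_space ::
    "nat \<Rightarrow> (nat \<Rightarrow> 'a::euclidean_space) \<Rightarrow> (nat \<Rightarrow> real) \<Rightarrow> (nat \<Rightarrow> complex) set" where
  "polytope_space m a b =
     {z \<in> {1..m} \<rightarrow>\<^sub>E UNIV. moment_map m z \<in> polytope_map m a b ` presented_polytope m a b}"

definition arrangement_complement ::
    "nat \<Rightarrow> (nat \<Rightarrow> 'a::euclidean_space) \<Rightarrow> (nat \<Rightarrow> real) \<Rightarrow> (nat \<Rightarrow> complex) set" where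
  "arrangement_complement m a b =
     polyhedral_product m UNIV (UNIV - {0}) (polytope_hypergraph m a b)"


section \<open>Elementary facts about the definitions\<close>

lemma simplicial_closure_eq:
  assumes "G \<subseteq> Pow {1..m}" "G \<noteq> {}"
  shows "simplicial_closure m G = {\<beta>. \<exists>\<alpha>\<in>G. \<beta> \<subseteq> \<alpha>}"
proof -
  have "abstract_complex m {\<beta>. \<exists>\<alpha>\<in>G. \<beta> \<subseteq> \<alpha>}"
    unfolding abstract_complex_def
  proof (intro conjI ballI allI impI)
    show "{\<beta>. \<exists>\<alpha>\<in>G. \<beta> \<subseteq> \<alpha>} \<subseteq> Pow {1..m}"
      using assms(1) by blast
    show "{} \<in> {\<beta>. \<exists>\<alpha>\<in>G. \<beta> \<subseteq> \<alpha>}"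
      using assms(2) by blast
    show "\<gamma> \<in> {\<beta>. \<exists>\<alpha>\<in>G. \<beta> \<subseteq> \<alpha>}" if "\<beta> \<in> {\<beta>. \<exists>\<alpha>\<in>G. \<beta> \<subseteq> \<alpha>}" "\<gamma> \<subseteq> \<beta>" for \<beta> \<gamma>
      using that subset_trans[of \<gamma> \<beta>] by blast
  qed
  then have "simplicial_closure m G \<subseteq> {\<beta>. \<exists>\<alpha>\<in>G. \<beta> \<subseteq> \<alpha>}"
    unfolding simplicial_closure_def hull_def by (intro Inter_lower) auto
  moreover have "{\<beta>. \<exists>\<alpha>\<in>G. \<beta> \<subseteq> \<alpha>} \<subseteq> simplicial_closure m G"
    unfolding simplicial_closure_def hull_def abstract_complex_def by blast
  ultimately show ?thesis by blast
qed

lemma polytope_complex_iff: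
  assumes "presented_polytope m a b \<noteq> {}"
  shows "\<sigma> \<in> polytope_complex m a b \<longleftrightarrow>
    \<sigma> \<subseteq> {1..m} \<and> presented_polytope m a b \<inter> (\<Inter>i\<in>\<sigma>. presented_facet m a b i) \<noteq> {}"
proof -
  have "polytope_complex m a b = {\<beta>. \<exists>\<alpha>\<in>polytope_hypergraph m a b. \<beta> \<subseteq> \<alpha>}"
    unfolding polytope_complex_def
    by (rule simplicial_closure_eq) (use assms in \<open>auto simp: polytope_hypergraph_def\<close>)
  then have "\<sigma> \<in> polytope_complex m a b \<longleftrightarrow>
      (\<exists>x\<in>presented_polytope m a b. \<sigma> \<subseteq> {i\<in>{1..m}. x \<in> presented_facet m a b i})"
    unfolding polytope_hypergraph_def by simp
  also have "\<dots> \<longleftrightarrow> \<sigma> \<subseteq> {1..m} \<and>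
      (\<exists>x\<in>presented_polytope m a b. \<forall>i\<in>\<sigma>. x \<in> presented_facet m a b i)"
    unfolding subset_iff mem_Collect_eq by metis
  also have "(\<exists>x\<in>presented_polytope m a b. \<forall>i\<in>\<sigma>. x \<in> presented_facet m a b i) \<longleftrightarrow>
      presented_polytope m a b \<inter> (\<Inter>i\<in>\<sigma>. presented_facet m a b i) \<noteq> {}"
    unfolding ex_in_conv[symmetric] Int_iff INT_iff Bex_def ..
  finally show ?thesis .
qed

lemma polyhedral_product_simplicial_closure:
  assumes "G \<subseteq> Pow {1..m}" "G \<noteq> {}" "A \<subseteq> X"
  shows "polyhedral_product m X A (simplicial_closure m G) = polyhedral_product m X A G"
proof
  show "polyhedral_product m X A (simplicial_closure m G) \<subseteq> polyhedral_product m X A G"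
  proof
    fix z assume "z \<in> polyhedral_product m X A (simplicial_closure m G)"
    then obtain \<alpha> \<beta> where "\<alpha> \<in> G" "\<beta> \<subseteq> \<alpha>" "z \<in> (\<Pi>\<^sub>E i\<in>{1..m}. if i \<in> \<beta> then X else A)"
      unfolding polyhedral_product_def simplicial_closure_eq[OF assms(1,2)] by auto
    moreover from this have "z \<in> (\<Pi>\<^sub>E i\<in>{1..m}. if i \<in> \<alpha> then X else A)"
      using assms(3) by (auto simp: PiE_iff split: if_splits)
    ultimately show "z \<in> polyhedral_product m X A G"
      unfolding polyhedral_product_def by blast
  qed
  show "polyhedral_product m X A G \<subseteq> polyhedral_product m X A (simplicial_closure m G)"
    unfolding polyhedral_product_def simplicial_closure_eq[OF assms(1,2)] by auto
qed

lemma arrangement_complement_complex: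
  assumes "presented_polytope m a b \<noteq> {}"
  shows "arrangement_complement m a b =
    polyhedral_product m UNIV (UNIV - {0}) (polytope_complex m a b)"
  unfolding arrangement_complement_def polytope_complex_def
  by (rule polyhedral_product_simplicial_closure[symmetric])
     (use assms in \<open>auto simp: polytope_hypergraph_def\<close>)

lemma group_circle_group: "group circle_group"
proof (rule groupI)
  fix x assume "x \<in> carrier circle_group"
  then show "\<exists>y\<in>carrier circle_group. y \<otimes>\<^bsub>circle_group\<^esub> x = \<one>\<^bsub>circle_group\<^esub>"
    by (intro bexI[of _ "inverse x"]) (auto simp: circle_group_def norm_inverse intro!: left_inverse)
qed (auto simp: circle_group_def norm_mult)

lemma group_torus: "group (torus k)"
  unfolding torus_def using group_circle_group by simp

lemma carrier_torus: "carrier (torus k) = {1..k} \<rightarrow>\<^sub>E sphere 0 1"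
  and mult_torus: "x \<otimes>\<^bsub>torus k\<^esub> y = (\<lambda>i\<in>{1..k}. x i * y i)"
  and one_torus: "\<one>\<^bsub>torus k\<^esub> = (\<lambda>i\<in>{1..k}. 1)"
  by (simp_all add: torus_def circle_group_def)

lemma topspace_torus: "topspace (torus_topology k) = carrier (torus k)"
  by (simp add: torus_topology_def carrier_torus)

lemma toric_subgroup_rank_le:
  assumes "toric_subgroup m k H"
  shows "k \<le> m"
proof -
  have tors: "{x \<in> carrier (torus j). x \<otimes>\<^bsub>torus j\<^esub> x = \<one>\<^bsub>torus j\<^esub>} = {1..j} \<rightarrow>\<^sub>E {1, -1}" for j
  proof -
    have "x \<otimes>\<^bsub>torus j\<^esub> x = \<one>\<^bsub>torus j\<^esub> \<longleftrightarrow> (\<forall>i\<in>{1..j}. x i * x i = 1)" for x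
      unfolding mult_torus one_torus by (auto simp: restrict_def fun_eq_iff)
    moreover have "w \<in> sphere 0 1 \<and> w * w = 1 \<longleftrightarrow> w \<in> {1, -1}" for w :: complex
      by (auto simp: square_eq_1_iff)
    ultimately show ?thesis
      unfolding carrier_torus set_eq_iff mem_Collect_eq PiE_iff by blast
  qed
  obtain f where f: "f \<in> iso (torus k) (torus m \<lparr>carrier := H\<rparr>)" and H: "subgroup H (torus m)"
    using assms unfolding toric_subgroup_def by blast
  have inj: "inj_on f (carrier (torus k))" and im: "f ` carrier (torus k) \<subseteq> carrier (torus m)"
    using f subgroup.subset[OF H] by (auto simp: iso_def bij_betw_def)
  have hom: "f \<in> hom (torus k) (torus m)"
    using f im by (auto simp: iso_def hom_def)
  have one: "f \<one>\<^bsub>torus k\<^esub> = \<one>\<^bsub>torus m\<^esub>"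
    using hom_one[OF hom group_torus group_torus] .
  have sub: "f ` ({1..k} \<rightarrow>\<^sub>E {1, -1}) \<subseteq> {1..m} \<rightarrow>\<^sub>E {1, -1}"
    unfolding tors[symmetric]
  proof clarify
    fix x assume "x \<in> carrier (torus k)" "x \<otimes>\<^bsub>torus k\<^esub> x = \<one>\<^bsub>torus k\<^esub>"
    then show "f x \<in> carrier (torus m) \<and> f x \<otimes>\<^bsub>torus m\<^esub> f x = \<one>\<^bsub>torus m\<^esub>"
      using im one hom_mult[OF hom, of x x] by (metis image_subset_iff)
  qed
  have "inj_on f ({1..k} \<rightarrow>\<^sub>E {1, -1})"
    unfolding tors[symmetric] using inj by (rule inj_on_subset) blast
  then have "card ({1..k} \<rightarrow>\<^sub>E {1, -1 :: complex}) \<le> card ({1..m} \<rightarrow>\<^sub>E {1, -1 :: complex})"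
    using sub by (rule card_inj_on_le) (simp add: finite_PiE)
  then show ?thesis
    by (simp add: card_PiE)
qed

lemma acts_freely_iff:
  assumes Z: "Z \<subseteq> {1..m} \<rightarrow>\<^sub>E UNIV"
    and stable: "\<And>t z. t \<in> carrier (torus m) \<Longrightarrow> z \<in> Z \<Longrightarrow> (\<lambda>i\<in>{1..m}. t i * z i) \<in> Z"
    and H: "subgroup H (torus m)"
  shows "acts_freely m H Z \<longleftrightarrow>
    (\<forall>t\<in>H. \<forall>z\<in>Z. (\<lambda>i\<in>{1..m}. t i * z i) = z \<longrightarrow> t = (\<lambda>i\<in>{1..m}. 1))"
proof -
  interpret T: group "torus m" by (rule group_torus)
  let ?H = "torus m \<lparr>carrier := H\<rparr>" and ?\<phi> = "coordinatewise_action m Z"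
  have Hsub: "H \<subseteq> carrier (torus m)" by (rule subgroup.subset[OF H])
  have in_Z: "?\<phi> t z \<in> Z" if "t \<in> H" "z \<in> Z" for t z
    using that stable Hsub by (auto simp: coordinatewise_action_def)
  have comp: "?\<phi> (s \<otimes>\<^bsub>torus m\<^esub> t) z = ?\<phi> s (?\<phi> t z)" if "s \<in> H" "t \<in> H" "z \<in> Z" for s t z
    using that in_Z[OF that(2,3)]
    by (auto simp: coordinatewise_action_def mult_torus mult.assoc intro!: restrict_ext)
  have unit: "?\<phi> \<one>\<^bsub>torus m\<^esub> z = z" if "z \<in> Z" for z
  proof -
    have "(\<lambda>i\<in>{1..m}. z i) = z"
      using that Z by (intro extensional_restrict) (auto simp: PiE_def)
    moreover have "?\<phi> \<one>\<^bsub>torus m\<^esub> z = (\<lambda>i\<in>{1..m}. z i)"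
      using that by (auto simp: coordinatewise_action_def one_torus intro!: restrict_ext)
    ultimately show ?thesis by simp
  qed
  have bij: "?\<phi> t \<in> Bij Z" if t: "t \<in> H" for t
  proof -
    have t': "inv\<^bsub>torus m\<^esub> t \<in> H" using t subgroup.m_inv_closed[OF H] by blast
    have tc: "t \<in> carrier (torus m)" using t Hsub by blast
    have "bij_betw (?\<phi> t) Z Z"
    proof (rule bij_betw_byWitness[where f' = "?\<phi> (inv\<^bsub>torus m\<^esub> t)"])
      show "\<forall>z\<in>Z. ?\<phi> (inv\<^bsub>torus m\<^esub> t) (?\<phi> t z) = z"
        using comp[OF t' t] unit T.l_inv[OF tc] by metis
      show "\<forall>z\<in>Z. ?\<phi> t (?\<phi> (inv\<^bsub>torus m\<^esub> t) z) = z"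
        using comp[OF t t'] unit T.r_inv[OF tc] by metis
    qed (use in_Z t t' in auto)
    then show ?thesis by (simp add: Bij_def coordinatewise_action_def)
  qed
  have "?\<phi> (s \<otimes>\<^bsub>torus m\<^esub> t) = compose Z (?\<phi> s) (?\<phi> t)" if "s \<in> H" "t \<in> H" for s t
    using comp[OF that] unfolding compose_def
    by (intro extensionalityI[of _ Z]) (auto simp: coordinatewise_action_def)
  then have "?\<phi> \<in> hom ?H (BijGroup Z)"
    using bij by (auto simp: hom_def BijGroup_def)
  then have act: "group_action ?H Z ?\<phi>"
    unfolding group_action_def group_hom_def group_hom_axioms_def
    using group_BijGroup subgroup.subgroup_is_group[OF H group_torus] by blast
  have "\<one>\<^bsub>torus m\<^esub> \<in> H" by (rule subgroup.one_closed[OF H])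
  then have "stabilizer ?H ?\<phi> z = {\<one>\<^bsub>torus m\<^esub>} \<longleftrightarrow>
      (\<forall>t\<in>H. (\<lambda>i\<in>{1..m}. t i * z i) = z \<longrightarrow> t = (\<lambda>i\<in>{1..m}. 1))" if "z \<in> Z" for z
    using that unit[OF that] unfolding stabilizer_def
    by (auto simp: coordinatewise_action_def one_torus)
  then show ?thesis
    unfolding acts_freely_def using act by auto
qed

lemma trivial_acts_freely:
  assumes "Z \<subseteq> {1..m} \<rightarrow>\<^sub>E UNIV"
    and "\<And>t z. t \<in> carrier (torus m) \<Longrightarrow> z \<in> Z \<Longrightarrow> (\<lambda>i\<in>{1..m}. t i * z i) \<in> Z"
  shows "toric_subgroup m 0 {\<one>\<^bsub>torus m\<^esub>}" "acts_freely m {\<one>\<^bsub>torus m\<^esub>} Z"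
proof -
  interpret T: group "torus m" by (rule group_torus)
  have H: "subgroup {\<one>\<^bsub>torus m\<^esub>} (torus m)" by (rule T.triv_subgroup)
  have c0: "carrier (torus 0) = {\<lambda>_. undefined}" by (simp add: carrier_torus)
  have top: "topspace (subtopology (torus_topology m) {\<one>\<^bsub>torus m\<^esub>}) = {\<one>\<^bsub>torus m\<^esub>}"
    by (auto simp: topspace_torus)
  have "(\<lambda>_. \<one>\<^bsub>torus m\<^esub>) \<in> iso (torus 0) (torus m \<lparr>carrier := {\<one>\<^bsub>torus m\<^esub>}\<rparr>)"
    unfolding iso_def hom_def bij_betw_def by (auto simp: c0)
  moreover have "homeomorphic_map (torus_topology 0)
      (subtopology (torus_topology m) {\<one>\<^bsub>torus m\<^esub>}) (\<lambda>_. \<one>\<^bsub>torus m\<^esub>)"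
    by (rule homeomorphic_maps_imp_map[where g = "\<lambda>_ _. undefined"])
       (auto simp: homeomorphic_maps_def topspace_torus c0 top simp del: topspace_subtopology
        intro!: continuous_map_const[THEN iffD2])
  ultimately show "toric_subgroup m 0 {\<one>\<^bsub>torus m\<^esub>}"
    unfolding toric_subgroup_def using H by blast
  show "acts_freely m {\<one>\<^bsub>torus m\<^esub>} Z"
    using acts_freely_iff[OF assms H] by (simp add: one_torus)
qed

end

theory Submission
  imports Defs
begin

text \<open>
  A torus element fixes a point exactly when it is trivial at every coordinate where the point does
  not vanish, so whether a subgroup acts freely depends only on the maximal sets of vanishing
  coordinates. For all four spaces these are the maximal members of the hypergraph of the polytope.
\<close>

lemma acts_freely_iff_vanishing:
  assumes Z: "Z \<subseteq> {1..m} \<rightarrow>\<^sub>E UNIV"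
    and stable: "\<And>t z. t \<in> carrier (torus m) \<Longrightarrow> z \<in> Z \<Longrightarrow> (\<lambda>i\<in>{1..m}. t i * z i) \<in> Z"
    and H: "subgroup H (torus m)"
    and vanishing_le: "\<And>z. z \<in> Z \<Longrightarrow> \<exists>\<alpha>\<in>G. {i\<in>{1..m}. z i = 0} \<subseteq> \<alpha>"
    and vanishing_ge: "\<And>\<alpha>. \<alpha> \<in> G \<Longrightarrow> \<exists>z\<in>Z. \<forall>i\<in>{1..m} \<inter> \<alpha>. z i = 0"
  shows "acts_freely m H Z \<longleftrightarrow>
    (\<forall>t\<in>H. \<forall>\<alpha>\<in>G. (\<forall>i\<in>{1..m} - \<alpha>. t i = 1) \<longrightarrow> t = (\<lambda>i\<in>{1..m}. 1))"
proof -
  have fix_iff: "(\<lambda>i\<in>{1..m}. t i * z i) = z \<longleftrightarrow> (\<forall>i\<in>{1..m}. z i \<noteq> 0 \<longrightarrow> t i = 1)" if "z \<in> Z" for t z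
  proof -
    have "z = (\<lambda>i\<in>{1..m}. z i)"
      using that Z by (intro extensional_restrict[symmetric]) (auto simp: PiE_def)
    then have "(\<lambda>i\<in>{1..m}. t i * z i) = z \<longleftrightarrow> (\<lambda>i\<in>{1..m}. t i * z i) = (\<lambda>i\<in>{1..m}. z i)"
      by simp
    also have "\<dots> \<longleftrightarrow> (\<forall>i\<in>{1..m}. t i * z i = z i)"
      by (auto simp: fun_eq_iff restrict_def)
    also have "\<dots> \<longleftrightarrow> (\<forall>i\<in>{1..m}. z i \<noteq> 0 \<longrightarrow> t i = 1)"
      by auto
    finally show ?thesis .
  qed
  \<comment> \<open>Freeness depends only on which \<open>t\<close> fix some point of
    \<open>Z\<close>, so it is enough to describe these elements through \<open>G\<close>.\<close>
  have "(\<exists>z\<in>Z. (\<lambda>i\<in>{1..m}. t i * z i) = z) \<longleftrightarrow> (\<exists>\<alpha>\<in>G. \<forall>i\<in>{1..m} - \<alpha>. t i = 1)" for t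
  proof
    assume "\<exists>z\<in>Z. (\<lambda>i\<in>{1..m}. t i * z i) = z"
    then obtain z where z: "z \<in> Z" "\<forall>i\<in>{1..m}. z i \<noteq> 0 \<longrightarrow> t i = 1"
      using fix_iff by blast
    obtain \<alpha> where "\<alpha> \<in> G" "{i\<in>{1..m}. z i = 0} \<subseteq> \<alpha>"
      using vanishing_le[OF z(1)] by blast
    with z(2) show "\<exists>\<alpha>\<in>G. \<forall>i\<in>{1..m} - \<alpha>. t i = 1"
      by blast
  next
    assume "\<exists>\<alpha>\<in>G. \<forall>i\<in>{1..m} - \<alpha>. t i = 1"
    then obtain \<alpha> where \<alpha>: "\<alpha> \<in> G" "\<forall>i\<in>{1..m} - \<alpha>. t i = 1"
      by blast
    obtain z where "z \<in> Z" "\<forall>i\<in>{1..m} \<inter> \<alpha>. z i = 0"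
      using vanishing_ge[OF \<alpha>(1)] by blast
    with \<alpha>(2) fix_iff show "\<exists>z\<in>Z. (\<lambda>i\<in>{1..m}. t i * z i) = z"
      by blast
  qed
  moreover have "acts_freely m H Z \<longleftrightarrow>
      (\<forall>t\<in>H. (\<exists>z\<in>Z. (\<lambda>i\<in>{1..m}. t i * z i) = z) \<longrightarrow> t = (\<lambda>i\<in>{1..m}. 1))"
    using acts_freely_iff[OF Z stable H] by blast
  ultimately show ?thesis
    by blast
qed

text \<open>Since \<open>A\<close> omits 0, a point in the block of \<alpha> vanishes only inside
  \<alpha>, and since 0 lies in \<open>X\<close>, all of \<alpha> can be reached. The assumptions
  are shaped to cover both the pair of disk and circle and the pair of the plane and the punctured
  plane.\<close>

lemma acts_freely_polyhedral_product:
  assumes H: "subgroup H (torus m)"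
    and zero: "0 \<in> X" "0 \<notin> A" and one: "1 \<in> A"
    and X: "\<And>t z. cmod t = 1 \<Longrightarrow> z \<in> X \<Longrightarrow> t * z \<in> X"
    and A: "\<And>t z. cmod t = 1 \<Longrightarrow> z \<in> A \<Longrightarrow> t * z \<in> A"
  shows "acts_freely m H (polyhedral_product m X A G) \<longleftrightarrow>
    (\<forall>t\<in>H. \<forall>\<alpha>\<in>G. (\<forall>i\<in>{1..m} - \<alpha>. t i = 1) \<longrightarrow> t = (\<lambda>i\<in>{1..m}. 1))"
proof (rule acts_freely_iff_vanishing[OF _ _ H])
  show "polyhedral_product m X A G \<subseteq> {1..m} \<rightarrow>\<^sub>E UNIV"
    by (auto simp: polyhedral_product_def PiE_def)
next
  fix t z assume t: "t \<in> carrier (torus m)" and "z \<in> polyhedral_product m X A G"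
  then obtain \<alpha> where "\<alpha> \<in> G" and z: "z \<in> (\<Pi>\<^sub>E i\<in>{1..m}. if i \<in> \<alpha> then X else A)"
    by (auto simp: polyhedral_product_def)
  have "cmod (t i) = 1" if "i \<in> {1..m}" for i
    using t that by (auto simp: carrier_torus PiE_iff)
  then have "(\<lambda>i\<in>{1..m}. t i * z i) \<in> (\<Pi>\<^sub>E i\<in>{1..m}. if i \<in> \<alpha> then X else A)"
    using z X A by (auto simp: PiE_iff split: if_splits)
  with \<open>\<alpha> \<in> G\<close> show "(\<lambda>i\<in>{1..m}. t i * z i) \<in> polyhedral_product m X A G"
    by (auto simp: polyhedral_product_def)
next
  fix z assume "z \<in> polyhedral_product m X A G"
  then obtain \<alpha> where "\<alpha> \<in> G" and z: "z \<in> (\<Pi>\<^sub>E i\<in>{1..m}. if i \<in> \<alpha> then X else A)"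
    by (auto simp: polyhedral_product_def)
  have "i \<in> \<alpha>" if "i \<in> {1..m}" "z i = 0" for i
    using PiE_mem[OF z that(1)] that(2) zero by (auto split: if_splits)
  with \<open>\<alpha> \<in> G\<close> show "\<exists>\<alpha>\<in>G. {i\<in>{1..m}. z i = 0} \<subseteq> \<alpha>"
    by blast
next
  fix \<alpha> assume "\<alpha> \<in> G"
  \<comment> \<open>Within \<open>{1..m}\<close> this 0-1 point vanishes exactly on
    \<alpha>.\<close>
  then have "(\<lambda>i\<in>{1..m}. if i \<in> \<alpha> then 0 else 1) \<in> polyhedral_product m X A G"
    using zero one by (auto simp: polyhedral_product_def)
  then show "\<exists>z\<in>polyhedral_product m X A G. \<forall>i\<in>{1..m} \<inter> \<alpha>. z i = 0"
    by (rule rev_bexI) auto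
qed

text \<open>Every point of the fibre over \<open>x\<close> vanishes exactly at the facets through
  \<open>x\<close>, so the vanishing sets are precisely the members of the hypergraph.\<close>

lemma acts_freely_polytope_space:
  assumes H: "subgroup H (torus m)"
  shows "acts_freely m H (polytope_space m a b) \<longleftrightarrow>
    (\<forall>t\<in>H. \<forall>\<alpha>\<in>polytope_hypergraph m a b.
      (\<forall>i\<in>{1..m} - \<alpha>. t i = 1) \<longrightarrow> t = (\<lambda>i\<in>{1..m}. 1))"
proof (rule acts_freely_iff_vanishing[OF _ _ H])
  show "polytope_space m a b \<subseteq> {1..m} \<rightarrow>\<^sub>E UNIV"
    by (auto simp: polytope_space_def)
next
  fix t z assume t: "t \<in> carrier (torus m)" and z: "z \<in> polytope_space m a b"
  have "cmod (t i) = 1" if "i \<in> {1..m}" for i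
    using t that by (auto simp: carrier_torus PiE_iff)
  then have "moment_map m (\<lambda>i\<in>{1..m}. t i * z i) = moment_map m z"
    by (auto simp: moment_map_def norm_mult intro!: restrict_ext)
  then show "(\<lambda>i\<in>{1..m}. t i * z i) \<in> polytope_space m a b"
    using z by (simp add: polytope_space_def)
next
  fix z assume "z \<in> polytope_space m a b"
  then obtain x where x: "x \<in> presented_polytope m a b" "moment_map m z = polytope_map m a b x"
    by (auto simp: polytope_space_def)
  have "(cmod (z i))\<^sup>2 = a i \<bullet> x + b i" if "i \<in> {1..m}" for i
    using fun_cong[OF x(2), of i] that by (simp add: moment_map_def polytope_map_def)
  then have "x \<in> presented_facet m a b i" if "i \<in> {1..m}" "z i = 0" for i
    using x(1) that by (force simp: presented_facet_def)
  then have "{i\<in>{1..m}. z i = 0} \<subseteq> {i\<in>{1..m}. x \<in> presented_facet m a b i}"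
    by blast
  then show "\<exists>\<alpha>\<in>polytope_hypergraph m a b. {i\<in>{1..m}. z i = 0} \<subseteq> \<alpha>"
    using x(1) unfolding polytope_hypergraph_def by blast
next
  fix \<alpha> assume "\<alpha> \<in> polytope_hypergraph m a b"
  then obtain x where x: "x \<in> presented_polytope m a b"
    and \<alpha>: "\<alpha> = {i\<in>{1..m}. x \<in> presented_facet m a b i}"
    by (auto simp: polytope_hypergraph_def)
  \<comment> \<open>The nonnegative real point of the fibre over \<open>x\<close>; the inequalities
    of the polytope make the squares of these roots return the values of the affine forms.\<close>
  define z where "z = (\<lambda>i\<in>{1..m}. complex_of_real (sqrt (a i \<bullet> x + b i)))"
  have "moment_map m z = polytope_map m a b x"
    using x by (auto simp: moment_map_def polytope_map_def z_def presented_polytope_def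
        intro!: restrict_ext)
  then have "z \<in> polytope_space m a b"
    using x by (auto simp: polytope_space_def z_def)
  moreover have "\<forall>i\<in>{1..m} \<inter> \<alpha>. z i = 0"
    by (auto simp: \<alpha> z_def presented_facet_def)
  ultimately show "\<exists>z\<in>polytope_space m a b. \<forall>i\<in>{1..m} \<inter> \<alpha>. z i = 0"
    by blast
qed

text \<open>Toric subgroups are subgroups of the torus, so both maxima range over the same set of
  ranks.\<close>

lemma buchstaber_number_cong:
  assumes "\<And>H. subgroup H (torus m) \<Longrightarrow> acts_freely m H Z \<longleftrightarrow> acts_freely m H Z'"
  shows "buchstaber_number m Z = buchstaber_number m Z'"
  unfolding buchstaber_number_def using assms by (metis toric_subgroup_def)

theorem proposition1:
  fixes a :: "nat \<Rightarrow> real ^ 'n" and b :: "nat \<Rightarrow> real" and m :: nat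
  assumes "bounded (presented_polytope m a b)"
    and "aff_dim (presented_polytope m a b) = int CARD('n)"
    and "bij_betw (presented_facet m a b) {1..m} {F. F facet_of presented_polytope m a b}"
  shows "buchstaber_number m (polytope_space m a b) =
           buchstaber_number m (moment_angle m (polytope_hypergraph m a b)) \<and>
         buchstaber_number m (moment_angle m (polytope_hypergraph m a b)) =
           buchstaber_number m (moment_angle m (polytope_complex m a b)) \<and>
         buchstaber_number m (moment_angle m (polytope_complex m a b)) =
           buchstaber_number m (arrangement_complement m a b)"
proof (intro conjI)
  let ?G = "polytope_hypergraph m a b"
  \<comment> \<open>The right-hand side mentions only \<open>H\<close> and \<open>?G\<close>; it
    serves as the common criterion for all the spaces.\<close>
  have moment_angle: "acts_freely m H (moment_angle m ?G) \<longleftrightarrow>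
      (\<forall>t\<in>H. \<forall>\<alpha>\<in>?G. (\<forall>i\<in>{1..m} - \<alpha>. t i = 1) \<longrightarrow> t = (\<lambda>i\<in>{1..m}. 1))"
    if "subgroup H (torus m)" for H
    unfolding moment_angle_def
    by (rule acts_freely_polyhedral_product[OF that]) (auto simp: norm_mult)
  have arrangement: "acts_freely m H (arrangement_complement m a b) \<longleftrightarrow>
      (\<forall>t\<in>H. \<forall>\<alpha>\<in>?G. (\<forall>i\<in>{1..m} - \<alpha>. t i = 1) \<longrightarrow> t = (\<lambda>i\<in>{1..m}. 1))"
    if "subgroup H (torus m)" for H
    unfolding arrangement_complement_def
    by (rule acts_freely_polyhedral_product[OF that]) auto
  \<comment> \<open>The empty set has affine dimension -1. Nonemptiness gives a nonempty hypergraph,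
    as the description of the simplicial closure requires.\<close>
  have "presented_polytope m a b \<noteq> {}"
    using assms(2) by (auto simp: aff_dim_empty)
  \<comment> \<open>The closure adds only subsets of members, and the circle lies in the disk, so
    each new block sits inside an old one: the two spaces coincide as sets.\<close>
  then have eq: "moment_angle m (polytope_complex m a b) = moment_angle m ?G"
    unfolding moment_angle_def polytope_complex_def
    by (intro polyhedral_product_simplicial_closure) (auto simp: polytope_hypergraph_def)
  show "buchstaber_number m (polytope_space m a b) = buchstaber_number m (moment_angle m ?G)"
    by (rule buchstaber_number_cong) (simp add: acts_freely_polytope_space moment_angle)
  show "buchstaber_number m (moment_angle m ?G) =
      buchstaber_number m (moment_angle m (polytope_complex m a b))"
    by (simp add: eq)
  show "buchstaber_number m (moment_angle m (polytope_complex m a b)) =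
      buchstaber_number m (arrangement_complement m a b)"
    unfolding eq by (rule buchstaber_number_cong) (simp add: moment_angle arrangement)
qed

end
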